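(* Fix $A$, $G$, $n$ and fix a linear operator $H:\mathbb{R}^{n^2}\to\mathbb{R}^{n^2}$. For $f,b\in\mathbb{R}^{n^2}$ define $$\Phi_H(u;G,f,b,n)=\Psi(u;G,f,b,n)+G\,H\bigl(\Psi(u;G,f,b,n)-u\bigr),\qquad u\in\mathbb{R}^{n^2}.$$ If for some $f_0,b_0\in\mathbb{R}^{n^2}$ the iterator $\Phi_H(\cdot\,;G,f_0,b_0,n)$ is valid for the PDE problem $(A,G,f_0,b_0,n)$, then for all $f,b\in\mathbb{R}^{n^2}$ the iterator $\Phi_H(\cdot\,;G,f,b,n)$ is valid for the PDE problem $(A,G,f,b,n)$.
   Context: A discretized PDE problem $(A,G,f,b,n)$ consists of a positive integer $n$, a matrix $A\in\mathbb{R}^{n^2\times n^2}$, a diagonal matrix $G\in\mathbb{R}^{n^2\times n^2}$ with diagonal entries in $\{0,1\}$ (entry $0$ exactly at the grid points where the value is prescribed), and vectors $f,b\in\mathbb{R}^{n^2}$. A solution of the problem is a vector $u\in\mathbb{R}^{n^2}$ with $GAu=Gf$ and $(I-G)u=(I-G)b$; only problems with a unique solution are considered. An iterator is a map $\Psi:\mathbb{R}^{n^2}\to\mathbb{R}^{n^2}$; it is linear if $\Psi(u)=Tu+c$ for a constant matrix $T\in\mathbb{R}^{n^2\times n^2}$ and a constant vector $c\in\mathbb{R}^{n^2}$. An iterator is valid for $(A,G,f,b,n)$ if (a) it has a unique fixed point $u^*$, and its iterates starting from any $u^0\in\mathbb{R}^{n^2}$ converge to $u^*$; and (b) $u^*$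 is the solution of the problem $(A,G,f,b,n)$. Standing assumptions: for every $f,b$, $\Psi(\cdot\,;G,f,b,n)$ is a linear iterator that is valid for $(A,G,f,b,n)$, of the form $\Psi(u;G,f,b,n)=Tu+c$, where the matrix $T$ depends only on $A,G,n$ (not on $f,b$), while the vector $c$ may depend on $f$ and $b$. *)

theory Defs
  imports "HOL-Analysis.Analysis"
begin

text \<open>The \<open>n \<times> n\<close> grid is the index type \<open>'n \<times> 'n\<close> with \<open>n = CARD('n)\<close>, so that the spaces
  below have dimension \<open>n\<^sup>2\<close>; every positive \<open>n\<close> arises from a suitable finite type.\<close>

type_synonym 'n grid_vec = "real ^ ('n \<times> 'n)"
type_synonym 'n grid_mat = "real ^ ('n \<times> 'n) ^ ('n \<times> 'n)"

definition diagonal_01 :: "'n::finite grid_mat \<Rightarrow> bool" where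
  "diagonal_01 G \<longleftrightarrow> (\<forall>i j. i \<noteq> j \<longrightarrow> G $ i $ j = 0) \<and> (\<forall>i. G $ i $ i \<in> {0, 1})"

definition is_solution ::
  "'n::finite grid_mat \<Rightarrow> 'n grid_mat \<Rightarrow> 'n grid_vec \<Rightarrow> 'n grid_vec \<Rightarrow> 'n grid_vec \<Rightarrow> bool" where
  "is_solution A G f b u \<longleftrightarrow>
     G *v (A *v u) = G *v f \<and> (mat 1 - G) *v u = (mat 1 - G) *v b"

definition pde_problem ::
  "'n::finite grid_mat \<Rightarrow> 'n grid_mat \<Rightarrow> 'n grid_vec \<Rightarrow> 'n grid_vec \<Rightarrow> bool" where
  "pde_problem A G f b \<longleftrightarrow> diagonal_01 G \<and> (\<exists>!u. is_solution A G f b u)"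

type_synonym 'n iterator = "'n grid_vec \<Rightarrow> 'n grid_vec"

definition linear_iterator_with :: "'n::finite grid_mat \<Rightarrow> 'n iterator \<Rightarrow> bool" where
  "linear_iterator_with T \<Psi> \<longleftrightarrow> (\<exists>c. \<forall>u. \<Psi> u = T *v u + c)"

definition valid_iterator ::
  "'n::finite grid_mat \<Rightarrow> 'n grid_mat \<Rightarrow> 'n grid_vec \<Rightarrow> 'n grid_vec \<Rightarrow> 'n iterator \<Rightarrow> bool" where
  "valid_iterator A G f b \<Psi> \<longleftrightarrow>
     (\<exists>!u. \<Psi> u = u) \<and>
     (\<forall>us. \<Psi> us = us \<longrightarrow>
        (\<forall>u0. (\<lambda>k. (\<Psi> ^^ k) u0) \<longlonglongrightarrow> us) \<and> is_solution A G f b us)"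

definition Phi ::
  "'n::finite iterator \<Rightarrow> 'n grid_mat \<Rightarrow> 'n iterator \<Rightarrow> 'n iterator" where
  "Phi H G \<Psi> u = \<Psi> u + G *v H (\<Psi> u - u)"

end

theory Submission
  imports Defs
begin

text \<open>
  The fixed point \<open>us\<close> of \<open>\<Psi> f b\<close> makes the correction \<open>G H (\<Psi> u - u)\<close> vanish, so it is also fixed
  by \<open>\<Phi>\<^sub>H\<close>; as \<open>\<Psi> f b\<close> is valid, it is the solution of the problem. What has to be transferred from
  \<open>(f0, b0)\<close> to \<open>(f, b)\<close> is the convergence of the iterates, and this is a property of the linear
  part alone: for all data, \<open>\<Phi>\<^sub>H u - \<Phi>\<^sub>H v = L (u - v)\<close> with the one operator
  \<open>L w = T w + G H (T w - w)\<close>. Iterating this identity (lemma \<open>funpow_diff\<close>) shows that the error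
  after \<open>k\<close> steps is \<open>L\<^sup>k\<close> applied to the initial error. Validity for \<open>(f0, b0)\<close> therefore says that
  \<open>L\<^sup>k w\<close> tends to \<open>0\<close> for every \<open>w\<close>, since every \<open>w\<close> is an initial error, and this in turn gives
  convergence for every \<open>(f, b)\<close>. Uniqueness of the fixed point then
  follows, because the iterates starting at a second fixed point are constant.
\<close>

lemma funpow_diff:
  fixes F L :: "'a::ab_group_add \<Rightarrow> 'a"
  assumes "\<And>u v. F u - F v = L (u - v)"
  shows "(F ^^ k) u - (F ^^ k) v = (L ^^ k) (u - v)"
  by (induction k) (simp_all add: assms)

lemma funpow_fixed_point: "F x = x \<Longrightarrow> (F ^^ k) x = x"
  by (induction k) simp_all

text \<open>The error identity holds for both maps with the same \<open>L\<close>; the start \<open>x + (u - y)\<close> gives the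
  first map the initial error that the start \<open>u\<close> gives the second.\<close>

lemma funpow_convergence_transfer:
  fixes F F' L :: "'a::real_normed_vector \<Rightarrow> 'a"
  assumes F: "\<And>u v. F u - F v = L (u - v)" and F': "\<And>u v. F' u - F' v = L (u - v)"
    and x: "F x = x" and y: "F' y = y"
    and conv: "\<And>u. (\<lambda>k. (F ^^ k) u) \<longlonglongrightarrow> x"
  shows "(\<lambda>k. (F' ^^ k) u) \<longlonglongrightarrow> y"
proof -
  have "(F' ^^ k) u - y = (F ^^ k) (x + (u - y)) - x" for k
    using funpow_diff[of F L k "x + (u - y)" x, OF F] funpow_diff[of F' L k u y, OF F']
    by (simp add: funpow_fixed_point x y)
  moreover have "(\<lambda>k. (F ^^ k) (x + (u - y)) - x) \<longlonglongrightarrow> 0"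
    using conv LIM_zero by blast
  ultimately show ?thesis
    by (simp add: LIM_zero_cancel)
qed

lemma valid_iteratorI:
  assumes fixed: "F us = us" and sol: "is_solution A G f b us"
    and conv: "\<And>u. (\<lambda>k. (F ^^ k) u) \<longlonglongrightarrow> us"
  shows "valid_iterator A G f b F"
proof -
  have "v = us" if "F v = v" for v
    using conv[of v] by (simp add: funpow_fixed_point[of F, OF that] LIMSEQ_const_iff)
  then show ?thesis
    unfolding valid_iterator_def using fixed sol conv by metis
qed

lemma Phi_diff:
  assumes "linear_iterator_with T \<Psi>" and H: "linear H"
  shows "Phi H G \<Psi> u - Phi H G \<Psi> v
    = T *v (u - v) + G *v H (T *v (u - v) - (u - v))"
proof -
  obtain c where c: "\<Psi> w = T *v w + c" for w
    using assms(1) unfolding linear_iterator_with_def by blast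
  have "H (T *v (u - v) - (u - v)) = H (\<Psi> u - u) - H (\<Psi> v - v)"
    unfolding linear_diff[OF H, symmetric] c
    by (simp add: matrix_vector_mult_diff_distrib algebra_simps)
  then show ?thesis
    by (simp add: Phi_def c matrix_vector_mult_diff_distrib)
qed

lemma Phi_fixed_point: "linear H \<Longrightarrow> \<Psi> us = us \<Longrightarrow> Phi H G \<Psi> us = us"
  by (simp add: Phi_def linear_0)

theorem proposition2:
  fixes A G T :: "'n::finite grid_mat"
    and H :: "'n grid_vec \<Rightarrow> 'n grid_vec"
    and \<Psi> :: "'n grid_vec \<Rightarrow> 'n grid_vec \<Rightarrow> 'n iterator"
    and f0 b0 :: "'n grid_vec"
  assumes problem: "\<And>f b. pde_problem A G f b"
    and lin: "\<And>f b. linear_iterator_with T (\<Psi> f b)"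
    and valid: "\<And>f b. valid_iterator A G f b (\<Psi> f b)"
    and H: "linear H"
    and valid0: "valid_iterator A G f0 b0 (Phi H G (\<Psi> f0 b0))"
  shows "\<forall>f b. valid_iterator A G f b (Phi H G (\<Psi> f b))"
proof (intro allI)
  fix f b
  obtain x where x: "Phi H G (\<Psi> f0 b0) x = x"
    and conv0: "\<And>u. (\<lambda>k. (Phi H G (\<Psi> f0 b0) ^^ k) u) \<longlonglongrightarrow> x"
    using valid0 unfolding valid_iterator_def by blast
  obtain us where us: "\<Psi> f b us = us" and sol: "is_solution A G f b us"
    using valid[of f b] unfolding valid_iterator_def by blast
  have fixed: "Phi H G (\<Psi> f b) us = us"
    using Phi_fixed_point[OF H, of "\<Psi> f b", OF us] .
  show "valid_iterator A G f b (Phi H G (\<Psi> f b))"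
    using fixed sol funpow_convergence_transfer[OF Phi_diff[OF lin H] Phi_diff[OF lin H] x fixed conv0]
    by (rule valid_iteratorI)
qed

end
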